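(* Assume (A2). For every $y\in\mathcal U$, $$E^{\rm ecc}(y)=\sum_{b\in\mathcal B,\ b\not\subset\Omega_c}\big(e_b(y)-c_b(y)\big)+E_c(y),$$ where $E^{\rm ecc}(y)=\sum_{b\in\mathcal B,\ b\not\subset\Omega_c}e_b(y)+\sum_{b\in\mathcal B,\ b\subset\Omega_c}c_b(y)$ and $E_c(y)=\sum_{T\in\mathcal T}\sum_{r\in\mathcal R}|T|\,\phi\big(D_r y|_T\big)$.
   Context: Two-dimensional setting. Let $\Omega\subset\mathbb R^2$ be open and bounded, $\Omega_a\subset\Omega$ open, $\Omega_c=\Omega\setminus\overline{\Omega_a}$ an open polygon with vertices in $\mathbb Z^2$, $\mathcal T$ a triangulation of $\overline{\Omega_c}$ by triangles with vertices in $\mathbb Z^2$, and $\mathcal P_1(\mathcal T)$ the continuous $\mathbb R^2$-valued functions on $\overline{\Omega_c}$ affine on each triangle. Let $\mathcal I=\Omega\cap\mathbb Z^2$, $\mathcal I_a=\Omega_a\cap\mathbb Z^2$, and $\mathcal R\subset\mathbb Z^2\setminus\{0\}$ finite. Assumption (A2): for every $r\in\mathcal R$ and every $i\in\mathbb Z^2$ with $(i,i+r)\cap\overline{\Omega_c}\neq\emptyset$, one has $i,i+r\in\mathcal I$. Let $\mathcal U=\{y:\mathcal I_a\cup\overline{\Omega_c}\to\mathbb R^2: y|_{\overline{\Omega_c}}\in\mathcal P_1(\mathcal T)\}$, $y_i=y(i)$. A bond $(x_1,x_2)$ is the open segment between $x_1,x_2$; $\mathcal B=\{(i,i+r): r\in\mathcal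 R,\ i,i+r\in\mathcal I\}$ (indexed by $(i,r)$). Bond average: $⨍_{(x_1,x_2)}f\,db=\int_0^1f((1-\lambda)x_1+\lambda x_2)d\lambda$. Directional derivative $D_ry(x)=\lim_{\varepsilon\to0}\frac{y(x+\varepsilon r)-y(x)}{\varepsilon}$; $D_r y|_T=(\nabla y|_T)\,r$ is the constant value on $T\in\mathcal T$. For a polygonal set $\omega$, $\chi_\omega(x)=\lim_{\rho\to0}|\omega\cap B_\rho(x)|/|B_\rho(x)|$ (so it is $1$ in the interior, $1/2$ on edges, $\alpha/2\pi$ at a vertex of angle $\alpha$, $0$ outside the closure). Let $\varphi:[0,\infty)\to\mathbb R$ be continuous and $\phi(z)=\varphi(|z|)$. Exact contribution $e_{(i,i+r)}(y)=\phi(y_{i+r}-y_i)$. Continuum contribution of any bond $b=(i,i+r)$: $c_b(y)=⨍_b\chi_{\Omega_c}\phi(D_ry)\,db$, where the integrand is taken to be $0$ wherever $\chi_{\Omega_c}=0$. *)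

theory Defs
  imports "HOL-Analysis.Analysis"
begin

type_synonym pt = "real^2"

definition Z2 :: "pt set" where
  "Z2 = {x. x$1 \<in> \<int> \<and> x$2 \<in> \<int>}"

text \<open>A triangulation by triangles with vertices in Z^2; each triangle is given by its
  vertex set V, the triangle itself being convex hull V. Conformity: two triangles meet
  in the convex hull of their common vertices (empty, a common vertex or a common edge).\<close>
definition lattice_triangulation :: "pt set set \<Rightarrow> pt set \<Rightarrow> bool" where
  "lattice_triangulation Tr S \<longleftrightarrow>
     finite Tr \<and>
     (\<forall>V\<in>Tr. card V = 3 \<and> V \<subseteq> Z2 \<and> \<not> collinear V) \<and>
     \<Union> ((\<lambda>V. convex hull V) ` Tr) = S \<and>
     (\<forall>V1\<in>Tr. \<forall>V2\<in>Tr. convex hull V1 \<inter> convex hull V2 = convex hull (V1 \<inter> V2))"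

text \<open>An open polygon with vertices in Z^2: a bounded regular open set whose closure is a
  finite union of lattice triangles (so its boundary consists of lattice segments).\<close>
definition open_lattice_polygon :: "pt set \<Rightarrow> bool" where
  "open_lattice_polygon \<omega> \<longleftrightarrow> open \<omega> \<and> bounded \<omega> \<and> \<omega> = interior (closure \<omega>) \<and>
     (\<exists>Tr. lattice_triangulation Tr (closure \<omega>))"

definition P1 :: "pt set set \<Rightarrow> pt set \<Rightarrow> (pt \<Rightarrow> pt) \<Rightarrow> bool" where
  "P1 Tr S y \<longleftrightarrow> continuous_on S y \<and>
     (\<forall>V\<in>Tr. \<exists>A c. linear A \<and> (\<forall>x\<in>convex hull V. y x = A x + c))"

definition Dr :: "(pt \<Rightarrow> pt) \<Rightarrow> pt \<Rightarrow> pt \<Rightarrow> pt" where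
  "Dr y r x = Lim (at (0::real)) (\<lambda>\<epsilon>. (y (x + \<epsilon> *\<^sub>R r) - y x) /\<^sub>R \<epsilon>)"

definition DrT :: "(pt \<Rightarrow> pt) \<Rightarrow> pt \<Rightarrow> pt set \<Rightarrow> pt" where
  "DrT y r V = (SOME v. \<forall>x\<in>interior (convex hull V). Dr y r x = v)"

definition chi :: "pt set \<Rightarrow> pt \<Rightarrow> real" where
  "chi \<omega> x = Lim (at_right (0::real))
      (\<lambda>\<rho>. measure lebesgue (\<omega> \<inter> ball x \<rho>) / measure lebesgue (ball x \<rho>))"

definition bond_avg :: "pt \<Rightarrow> pt \<Rightarrow> (pt \<Rightarrow> real) \<Rightarrow> real" where
  "bond_avg x1 x2 f = integral {0..1} (\<lambda>l. f ((1 - l) *\<^sub>R x1 + l *\<^sub>R x2))"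

definition phi :: "(real \<Rightarrow> real) \<Rightarrow> pt \<Rightarrow> real" where
  "phi \<phi> z = \<phi> (norm z)"

definition lattice_pts :: "pt set \<Rightarrow> pt set" where
  "lattice_pts \<Omega> = \<Omega> \<inter> Z2"

definition bonds :: "pt set \<Rightarrow> pt set \<Rightarrow> (pt \<times> pt) set" where
  "bonds \<Omega> R = {(i, r). r \<in> R \<and> i \<in> lattice_pts \<Omega> \<and> i + r \<in> lattice_pts \<Omega>}"

definition e_bond :: "(real \<Rightarrow> real) \<Rightarrow> (pt \<Rightarrow> pt) \<Rightarrow> pt \<times> pt \<Rightarrow> real" where
  "e_bond \<phi> y b = (case b of (i, r) \<Rightarrow> phi \<phi> (y (i + r) - y i))"

definition c_bond :: "(real \<Rightarrow> real) \<Rightarrow> pt set \<Rightarrow> (pt \<Rightarrow> pt) \<Rightarrow> pt \<times> pt \<Rightarrow> real" where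
  "c_bond \<phi> \<Omega>c y b = (case b of (i, r) \<Rightarrow>
     bond_avg i (i + r) (\<lambda>x. if chi \<Omega>c x = 0 then 0 else chi \<Omega>c x * phi \<phi> (Dr y r x)))"

definition E_ecc :: "(real \<Rightarrow> real) \<Rightarrow> pt set \<Rightarrow> pt set \<Rightarrow> pt set \<Rightarrow> (pt \<Rightarrow> pt) \<Rightarrow> real" where
  "E_ecc \<phi> \<Omega> \<Omega>c R y =
     (\<Sum>b\<in>{(i, r)\<in>bonds \<Omega> R. \<not> open_segment i (i + r) \<subseteq> \<Omega>c}. e_bond \<phi> y b) +
     (\<Sum>b\<in>{(i, r)\<in>bonds \<Omega> R. open_segment i (i + r) \<subseteq> \<Omega>c}. c_bond \<phi> \<Omega>c y b)"

definition E_c :: "(real \<Rightarrow> real) \<Rightarrow> pt set set \<Rightarrow> pt set \<Rightarrow> (pt \<Rightarrow> pt) \<Rightarrow> real" where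
  "E_c \<phi> Tr R y = (\<Sum>V\<in>Tr. \<Sum>r\<in>R. measure lebesgue (convex hull V) * phi \<phi> (DrT y r V))"

definition A2 :: "pt set \<Rightarrow> pt set \<Rightarrow> pt set \<Rightarrow> bool" where
  "A2 \<Omega> \<Omega>c R \<longleftrightarrow> (\<forall>r\<in>R. \<forall>i\<in>Z2. open_segment i (i + r) \<inter> closure \<Omega>c \<noteq> {} \<longrightarrow>
      i \<in> lattice_pts \<Omega> \<and> i + r \<in> lattice_pts \<Omega>)"

end

(* Writing chi as the sum of the densities of the triangles, everything reduces to Shapeev's bond
   density lemma: for a lattice triangle T and r in Z^2 - {0}, the averages of the density of T
   over the segments (i, i + r), i in Z^2, add up to |T|. Proof of that lemma: T and its point
   reflection T' (one closed, the other open) tile a half-open lattice parallelogram P, up to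
   lattice points. The number of i with i + x in P does not depend on x, since P is a fundamental
   domain of a sublattice. Averaging over x in the unit cell shows that it equals 2|T|; averaging
   over x = l r with 0 < l < 1 gives the segment averages of the closed and the open triangle,
   because the reflection i + l r -> c - i - l r permutes the segments. *)

theory Submission
  imports Defs
begin

section \<open>Counting lattice points\<close>

lemma Z2_add: "x \<in> Z2 \<Longrightarrow> y \<in> Z2 \<Longrightarrow> x + y \<in> Z2"
  and Z2_diff: "x \<in> Z2 \<Longrightarrow> y \<in> Z2 \<Longrightarrow> x - y \<in> Z2"
  and Z2_scaleR: "k \<in> \<int> \<Longrightarrow> x \<in> Z2 \<Longrightarrow> k *\<^sub>R x \<in> Z2"
  by (auto simp: Z2_def)

lemma finite_Z2_bounded:
  assumes "bounded S"
  shows "finite (Z2 \<inter> S)"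
proof -
  obtain B where B: "\<And>x. x \<in> S \<Longrightarrow> norm x \<le> B"
    using assms by (auto simp: bounded_iff)
  define K where "K = {p::int. \<bar>p\<bar> \<le> \<lceil>B\<rceil>}"
  have "K \<subseteq> {-\<lceil>B\<rceil>..\<lceil>B\<rceil>}"
    by (auto simp: K_def)
  then have fin: "finite K"
    by (rule finite_subset) simp
  have "Z2 \<inter> S \<subseteq> (\<lambda>(p, q). vector [of_int p, of_int q]) ` (K \<times> K)"
  proof
    fix x assume x: "x \<in> Z2 \<inter> S"
    then obtain p q where pq: "x$1 = of_int p" "x$2 = of_int q"
      by (auto simp: Z2_def elim!: Ints_cases)
    have "\<bar>x$k\<bar> \<le> B" for k
      using B[of x] component_le_norm_cart[of x k] x by auto
    from this[of 1] this[of 2] have "p \<in> K" "q \<in> K"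
      unfolding K_def pq by (auto simp: le_ceiling_iff)
    moreover have "x = vector [of_int p, of_int q]"
      by (simp add: vec_eq_iff forall_2 pq)
    ultimately show "x \<in> (\<lambda>(p, q). vector [of_int p, of_int q]) ` (K \<times> K)"
      by auto
  qed
  then show ?thesis
    by (rule finite_subset) (use fin in simp)
qed

text \<open>The value at \<open>x\<close> of the Z^2-periodization of the indicator of
  \<open>S\<close>. As \<open>card\<close> is 0 on infinite sets, this is meaningful for bounded
  \<open>S\<close>.\<close>

definition lattice_count :: "pt set \<Rightarrow> pt \<Rightarrow> nat" where
  "lattice_count S x = card {i \<in> Z2. i + x \<in> S}"

lemma finite_lattice_translate:
  assumes "bounded S"
  shows "finite {i \<in> Z2. i + x \<in> S}"
proof -
  have "{i \<in> Z2. i + x \<in> S} = Z2 \<inter> ((\<lambda>z. z - x) ` S)"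
    by (force simp: image_iff)
  then show ?thesis
    using finite_Z2_bounded[OF bounded_translation_minus[OF assms]] by simp
qed

text \<open>With one finite \<open>J\<close> valid for all \<open>x\<close> of an integration
  domain, the count becomes a finite sum of indicators and can be integrated term by term.\<close>

lemma lattice_count_eq_sum:
  assumes "finite J" "J \<subseteq> Z2" "\<And>i. i \<in> Z2 \<Longrightarrow> i + x \<in> S \<Longrightarrow> i \<in> J"
  shows "real (lattice_count S x) = (\<Sum>i\<in>J. indicator S (i + x))"
proof -
  have "{i \<in> Z2. i + x \<in> S} = J \<inter> {i. i + x \<in> S}"
    using assms by auto
  moreover have "(\<Sum>i\<in>J. indicator S (i + x)) = (\<Sum>i\<in>J. indicator {i. i + x \<in> S} i :: real)"
    by (simp add: indicator_def)
  ultimately show ?thesis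
    using assms(1) by (simp add: lattice_count_def indicator_def sum.If_cases Int_def)
qed

section \<open>The unit cell as a fundamental domain of Z^2\<close>

definition unit_cell :: "pt set" where
  "unit_cell = {x. 0 \<le> x$1 \<and> x$1 < 1 \<and> 0 \<le> x$2 \<and> x$2 < 1}"

lemma unit_cell_bounds: "box 0 1 \<subseteq> unit_cell" "unit_cell \<subseteq> cbox 0 1"
  by (auto simp: unit_cell_def mem_box_cart forall_2 less_imp_le)

lemma unit_cell_lmeasurable: "unit_cell \<in> lmeasurable"
proof (rule measurable_convex)
  show "bounded unit_cell"
    using bounded_subset[OF bounded_cbox unit_cell_bounds(2)] .
  show "convex unit_cell"
    unfolding unit_cell_def convex_alt
    by (auto simp: add_nonneg_nonneg convex_bound_lt)
qed

lemma measure_unit_cell: "measure lebesgue unit_cell = 1"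
proof -
  have c: "measure lebesgue (cbox (0::pt) 1) = 1" "measure lebesgue (box (0::pt) 1) = 1"
  proof -
    show c1: "measure lebesgue (cbox (0::pt) 1) = 1"
      by (subst measure_completion) (auto simp: content_cbox_cart interval_ne_empty_cart)
    \<comment> \<open>The open box is the interior of the closed one, whose frontier is a null set
      by convexity.\<close>
    show "measure lebesgue (box (0::pt) 1) = 1"
      using measure_interior[OF bounded_cbox negligible_convex_frontier[OF convex_box(1)], of "0::pt" 1] c1
      by (simp add: interior_cbox)
  qed
  have "measure lebesgue (box (0::pt) 1) \<le> measure lebesgue unit_cell"
    by (rule measure_mono_fmeasurable[OF unit_cell_bounds(1)]) (auto simp: unit_cell_lmeasurable)
  moreover have "measure lebesgue unit_cell \<le> measure lebesgue (cbox (0::pt) 1)"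
    by (rule measure_mono_fmeasurable[OF unit_cell_bounds(2)]) (auto simp: unit_cell_lmeasurable fmeasurableD)
  ultimately show ?thesis
    unfolding c by simp
qed

text \<open>The witness is the componentwise floor. The half-open sides make it unique, so the
  translates of the cell by Z^2 tile the plane.\<close>

lemma ex1_unit_cell: "\<exists>!i. i \<in> Z2 \<and> x - i \<in> unit_cell"
proof (rule ex1I)
  let ?i = "vector [of_int \<lfloor>x$1\<rfloor>, of_int \<lfloor>x$2\<rfloor>] :: pt"
  show "?i \<in> Z2 \<and> x - ?i \<in> unit_cell"
    by (auto simp: Z2_def unit_cell_def) linarith+
  fix i assume "i \<in> Z2 \<and> x - i \<in> unit_cell"
  then obtain p q where pq: "i$1 = of_int p" "i$2 = of_int q"
    and "0 \<le> x$1 - i$1" "x$1 - i$1 < 1" "0 \<le> x$2 - i$2" "x$2 - i$2 < 1"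
    by (auto simp: Z2_def unit_cell_def elim!: Ints_cases)
  then have "\<lfloor>x$1\<rfloor> = p" "\<lfloor>x$2\<rfloor> = q"
    by linarith+
  then show "i = ?i"
    by (simp add: vec_eq_iff forall_2 pq)
qed

text \<open>Unfolding: integrating a periodization over one cell amounts to integrating the original
  function over the plane, because the translated cells tile it.\<close>

lemma lattice_count_has_integral:
  assumes S: "S \<in> lmeasurable" "bounded S"
  shows "((\<lambda>x. real (lattice_count S x)) has_integral measure lebesgue S) unit_cell"
proof -
  \<comment> \<open>Only these \<open>i\<close> contribute for some \<open>x\<close> in the cell;
    they are finitely many since \<open>S\<close> and the cell are bounded.\<close>
  define J where "J = {i \<in> Z2. \<exists>x\<in>unit_cell. i + x \<in> S}"
  have bQ: "bounded unit_cell"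
    using bounded_subset[OF bounded_cbox unit_cell_bounds(2)] .
  obtain B C where BC: "\<And>x. x \<in> S \<Longrightarrow> norm x \<le> B" "\<And>x. x \<in> unit_cell \<Longrightarrow> norm x \<le> C"
    using S(2) bQ by (auto simp: bounded_iff)
  have "J \<subseteq> Z2 \<inter> cball 0 (B + C)"
  proof
    fix i assume "i \<in> J"
    then obtain x where x: "i \<in> Z2" "x \<in> unit_cell" "i + x \<in> S"
      by (auto simp: J_def)
    then show "i \<in> Z2 \<inter> cball 0 (B + C)"
      using norm_triangle_ineq4[of "i + x" x] BC(1)[of "i + x"] BC(2)[of x] by auto
  qed
  then have finJ: "finite J"
    by (rule finite_subset) (intro finite_Z2_bounded bounded_cball)
  have trans: "{x \<in> unit_cell. i + x \<in> S} = unit_cell \<inter> ((+) (- i) ` S)" for i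
    by (force simp: image_iff)
  have meas: "{x \<in> unit_cell. i + x \<in> S} \<in> lmeasurable" for i
    unfolding trans by (intro fmeasurable.Int measurable_translation unit_cell_lmeasurable S)
  \<comment> \<open>Translation by \<open>i\<close> turns the \<open>i\<close>-th term into the area
    of the part of \<open>S\<close> in the cell shifted by \<open>i\<close>.\<close>
  have 1: "((\<lambda>x. indicator S (i + x)) has_integral measure lebesgue (S \<inter> ((+) i ` unit_cell))) unit_cell" for i
  proof -
    have "measure lebesgue {x \<in> unit_cell. i + x \<in> S} = measure lebesgue ((+) i ` {x \<in> unit_cell. i + x \<in> S})"
      by (simp only: measure_translation)
    also have "(+) i ` {x \<in> unit_cell. i + x \<in> S} = S \<inter> ((+) i ` unit_cell)"
      by auto
    finally have "(indicator {x \<in> unit_cell. i + x \<in> S} has_integral measure lebesgue (S \<inter> ((+) i ` unit_cell))) UNIV"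
      using meas[of i] by (simp add: lmeasurable_iff_has_integral)
    moreover have "indicator {x \<in> unit_cell. i + x \<in> S} = (\<lambda>x. if x \<in> unit_cell then indicator S (i + x) else (0::real))"
      by (auto simp: indicator_def)
    ultimately show ?thesis
      by (simp only: has_integral_restrict_UNIV)
  qed
  have eq: "(\<Sum>i\<in>J. indicator S (i + x)) = real (lattice_count S x)" if "x \<in> unit_cell" for x
    using that by (intro lattice_count_eq_sum[symmetric] finJ) (auto simp: J_def)
  have "((\<lambda>x. \<Sum>i\<in>J. indicator S (i + x)) has_integral (\<Sum>i\<in>J. measure lebesgue (S \<inter> ((+) i ` unit_cell)))) unit_cell"
    by (intro has_integral_sum finJ 1)
  then have "((\<lambda>x. real (lattice_count S x)) has_integral (\<Sum>i\<in>J. measure lebesgue (S \<inter> ((+) i ` unit_cell)))) unit_cell"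
    by (rule has_integral_eq[rotated]) (use eq in simp)
  moreover have "(\<Sum>i\<in>J. measure lebesgue (S \<inter> ((+) i ` unit_cell))) = measure lebesgue (\<Union>i\<in>J. S \<inter> ((+) i ` unit_cell))"
  proof (rule measure_UNION'[symmetric, OF finJ])
    show "S \<inter> ((+) i ` unit_cell) \<in> lmeasurable" for i
      by (intro fmeasurable.Int measurable_translation unit_cell_lmeasurable S)
    have "disjnt ((+) i ` unit_cell) ((+) j ` unit_cell)" if "i \<in> J" "j \<in> J" "i \<noteq> j" for i j
      unfolding disjnt_iff
    proof (intro allI notI)
      fix x assume "x \<in> (+) i ` unit_cell \<and> x \<in> (+) j ` unit_cell"
      then have "x - i \<in> unit_cell" "x - j \<in> unit_cell"
        by (metis add_diff_cancel_left' imageE)+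
      then show False
        using ex1_unit_cell[of x] that by (auto simp: J_def)
    qed
    then show "pairwise (\<lambda>i j. disjnt (S \<inter> (+) i ` unit_cell) (S \<inter> (+) j ` unit_cell)) J"
      by (fastforce simp: pairwise_def disjnt_iff)
  qed
  moreover have "(\<Union>i\<in>J. S \<inter> ((+) i ` unit_cell)) = S"
  proof -
    have "x \<in> (\<Union>i\<in>J. S \<inter> ((+) i ` unit_cell))" if "x \<in> S" for x
    proof -
      obtain i where i: "i \<in> Z2" "x - i \<in> unit_cell"
        using ex1_unit_cell[of x] by auto
      then have "i \<in> J" "x \<in> (+) i ` unit_cell"
        using that by (auto simp: J_def image_iff intro!: bexI[of _ "x - i"])
      then show ?thesis
        using that by auto
    qed
    then show ?thesis
      by auto
  qed
  ultimately show ?thesis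
    by simp
qed

section \<open>The bond density lemma\<close>

text \<open>The triangle with vertices a, a + u, a + v; in terms of the dual basis m, n of u, v the
  barycentric coordinates of z are \<open>m \<bullet> (z - a)\<close>, \<open>n \<bullet> (z - a)\<close> and one minus their sum.\<close>
locale lattice_triangle =
  fixes a u v m n :: pt
  assumes lattice: "a \<in> Z2" "u \<in> Z2" "v \<in> Z2"
    and dual: "m \<bullet> u = 1" "m \<bullet> v = 0" "n \<bullet> u = 0" "n \<bullet> v = 1"
    and expand: "\<And>z. z = (m \<bullet> z) *\<^sub>R u + (n \<bullet> z) *\<^sub>R v"
begin

section \<open>The triangle, its reflection and the parallelogram in coordinates\<close>

definition tri :: "pt set" where
  "tri = {z. 0 \<le> m \<bullet> (z - a) \<and> 0 \<le> n \<bullet> (z - a) \<and> m \<bullet> (z - a) + n \<bullet> (z - a) \<le> 1}"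

text \<open>The open triangle reflected in the midpoint of the edge from \<open>a + u\<close> to
  \<open>a + v\<close>: coordinates (s, t) become (1 - s, 1 - t). Being open, it leaves the common
  edge to \<open>tri\<close>.\<close>

definition tri_refl :: "pt set" where
  "tri_refl = {z. m \<bullet> (z - a) < 1 \<and> n \<bullet> (z - a) < 1 \<and> m \<bullet> (z - a) + n \<bullet> (z - a) > 1}"

text \<open>Half-open, so that it contains exactly one point of every coset of the sublattice
  spanned by \<open>u\<close> and \<open>v\<close>.\<close>

definition para :: "pt set" where
  "para = {z. 0 \<le> m \<bullet> (z - a) \<and> m \<bullet> (z - a) < 1 \<and> 0 \<le> n \<bullet> (z - a) \<and> n \<bullet> (z - a) < 1}"

lemma coords_eqI: "m \<bullet> x = m \<bullet> y \<Longrightarrow> n \<bullet> x = n \<bullet> y \<Longrightarrow> x = y"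
  using expand[of x] expand[of y] by simp

text \<open>\<open>m\<close>, \<open>n\<close> and \<open>- (m + n)\<close> are inward normals of
  the three edges; the formulas for interiors of half-spaces and for half-ball densities require
  nonzero normals.\<close>

lemma mn_nonzero: "m \<noteq> 0" "n \<noteq> 0" "m + n \<noteq> 0"
  using dual by (auto simp: inner_add_left dest: arg_cong[where f = "\<lambda>x. x \<bullet> u"])

lemma norm_le_coords: "norm z \<le> \<bar>m \<bullet> z\<bar> * norm u + \<bar>n \<bullet> z\<bar> * norm v"
proof -
  have "norm z = norm ((m \<bullet> z) *\<^sub>R u + (n \<bullet> z) *\<^sub>R v)"
    using expand[of z] by simp
  also have "\<dots> \<le> \<bar>m \<bullet> z\<bar> * norm u + \<bar>n \<bullet> z\<bar> * norm v"
    by (metis norm_scaleR norm_triangle_ineq)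
  finally show ?thesis .
qed

lemma bounded_coords:
  assumes "\<And>z. z \<in> S \<Longrightarrow> \<bar>m \<bullet> (z - a)\<bar> \<le> 1 \<and> \<bar>n \<bullet> (z - a)\<bar> \<le> 1"
  shows "bounded S"
proof (rule bounded_subset)
  show "S \<subseteq> cball a (norm u + norm v)"
  proof
    fix z assume "z \<in> S"
    then have "\<bar>m \<bullet> (z - a)\<bar> * norm u \<le> 1 * norm u" "\<bar>n \<bullet> (z - a)\<bar> * norm v \<le> 1 * norm v"
      using assms by (blast intro: mult_right_mono norm_ge_zero)+
    then show "z \<in> cball a (norm u + norm v)"
      using norm_le_coords[of "z - a"] by (simp add: dist_norm norm_minus_commute)
  qed
qed simp

lemma bounded_tri: "bounded tri" and bounded_tri_refl: "bounded tri_refl"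
  and bounded_para: "bounded para"
  by (rule bounded_coords; auto simp: tri_def tri_refl_def para_def)+

lemma convex_tri: "convex tri"
proof -
  have "tri = {z. m \<bullet> z \<ge> m \<bullet> a} \<inter> {z. n \<bullet> z \<ge> n \<bullet> a} \<inter> {z. (m + n) \<bullet> z \<le> 1 + (m + n) \<bullet> a}"
    by (auto simp: tri_def inner_diff_right inner_add_left)
  then show ?thesis
    by (simp add: convex_Int convex_halfspace_ge convex_halfspace_le)
qed

lemma interior_tri:
  "interior tri = {z. 0 < m \<bullet> (z - a) \<and> 0 < n \<bullet> (z - a) \<and> m \<bullet> (z - a) + n \<bullet> (z - a) < 1}"
proof -
  have "tri = {z. m \<bullet> z \<ge> m \<bullet> a} \<inter> {z. n \<bullet> z \<ge> n \<bullet> a} \<inter> {z. (m + n) \<bullet> z \<le> 1 + (m + n) \<bullet> a}"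
    by (auto simp: tri_def inner_diff_right inner_add_left)
  then have "interior tri = {z. m \<bullet> z > m \<bullet> a} \<inter> {z. n \<bullet> z > n \<bullet> a} \<inter> {z. (m + n) \<bullet> z < 1 + (m + n) \<bullet> a}"
    using mn_nonzero by (simp only: interior_Int interior_halfspace_ge interior_halfspace_le not_False_eq_True)
  also have "\<dots> = {z. 0 < m \<bullet> (z - a) \<and> 0 < n \<bullet> (z - a) \<and> m \<bullet> (z - a) + n \<bullet> (z - a) < 1}"
    by (auto simp: inner_diff_right inner_add_left)
  finally show ?thesis .
qed

lemma interior_tri_nonempty: "interior tri \<noteq> {}"
proof -
  have "a + (1/3) *\<^sub>R u + (1/3) *\<^sub>R v \<in> interior tri"
    by (simp add: interior_tri inner_add_right dual)
  then show ?thesis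
    by blast
qed

lemma tri_refl_eq: "tri_refl = (\<lambda>z. (- 1) *\<^sub>R z + (2 *\<^sub>R a + u + v)) ` interior tri"
proof -
  have "z \<in> tri_refl \<longleftrightarrow> 2 *\<^sub>R a + u + v - z \<in> interior tri" for z
    by (auto simp: tri_refl_def interior_tri inner_diff_right inner_add_right dual)
  then show ?thesis
    by (force simp: image_iff)
qed

lemma tri_lmeasurable: "tri \<in> lmeasurable" "interior tri \<in> lmeasurable" "tri_refl \<in> lmeasurable"
proof -
  show "tri \<in> lmeasurable" "interior tri \<in> lmeasurable"
    by (auto intro: measurable_convex convex_tri bounded_tri convex_interior bounded_interior)
  show "tri_refl \<in> lmeasurable"
  proof (rule measurable_convex[OF _ bounded_tri_refl])
    show "convex tri_refl"
    proof -
      have "tri_refl = {z. m \<bullet> z < 1 + m \<bullet> a} \<inter> {z. n \<bullet> z < 1 + n \<bullet> a} \<inter> {z. (m + n) \<bullet> z > 1 + (m + n) \<bullet> a}"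
        by (auto simp: tri_refl_def inner_diff_right inner_add_left)
      then show ?thesis
        by (simp add: convex_Int convex_halfspace_lt convex_halfspace_gt)
    qed
  qed
qed

lemma measure_interior_tri: "measure lebesgue (interior tri) = measure lebesgue tri"
  by (intro measure_interior bounded_tri negligible_convex_frontier convex_tri)

lemma measure_tri_refl: "measure lebesgue tri_refl = measure lebesgue tri"
  unfolding tri_refl_eq measure_lebesgue_affine by (simp add: measure_interior_tri)

text \<open>Reducing modulo the sublattice spanned by u and v maps the lattice points counted at
  \<open>x\<close> injectively to those counted at \<open>x'\<close>.\<close>
lemma lattice_count_para_le: "lattice_count para x \<le> lattice_count para x'"
  unfolding lattice_count_def
proof (rule card_inj_on_le)
  define f where "f i = i - of_int \<lfloor>m \<bullet> (i + x' - a)\<rfloor> *\<^sub>R u - of_int \<lfloor>n \<bullet> (i + x' - a)\<rfloor> *\<^sub>R v" for i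
  show "finite {i \<in> Z2. i + x' \<in> para}"
    by (rule finite_lattice_translate[OF bounded_para])
  have "f i + x' \<in> para" for i
  proof -
    have "m \<bullet> (f i + x' - a) = frac (m \<bullet> (i + x' - a))" "n \<bullet> (f i + x' - a) = frac (n \<bullet> (i + x' - a))"
      by (simp_all add: f_def frac_def inner_diff_right inner_add_right dual)
    then show ?thesis
      by (simp add: para_def frac_ge_0 frac_lt_1)
  qed
  then show "f ` {i \<in> Z2. i + x \<in> para} \<subseteq> {i \<in> Z2. i + x' \<in> para}"
    by (auto simp: f_def intro!: Z2_diff Z2_scaleR lattice)
  show "inj_on f {i \<in> Z2. i + x \<in> para}"
  proof (rule inj_onI)
    fix i j assume i: "i \<in> {i \<in> Z2. i + x \<in> para}" and j: "j \<in> {i \<in> Z2. i + x \<in> para}"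
      and eq: "f i = f j"
    define k l where "k = \<lfloor>m \<bullet> (i + x' - a)\<rfloor> - \<lfloor>m \<bullet> (j + x' - a)\<rfloor>"
      and "l = \<lfloor>n \<bullet> (i + x' - a)\<rfloor> - \<lfloor>n \<bullet> (j + x' - a)\<rfloor>"
    have d: "i - j = of_int k *\<^sub>R u + of_int l *\<^sub>R v"
      using eq by (simp add: f_def k_def l_def algebra_simps)
    have kl: "m \<bullet> i - m \<bullet> j = of_int k" "n \<bullet> i - n \<bullet> j = of_int l"
      using arg_cong[OF d, of "\<lambda>z. m \<bullet> z"] arg_cong[OF d, of "\<lambda>z. n \<bullet> z"]
      by (simp_all add: inner_diff_right inner_add_right dual)
    \<comment> \<open>The coordinates of \<open>i - j\<close> are differences of two numbers in [0,
      1).\<close>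
    have "\<bar>of_int k :: real\<bar> < 1" "\<bar>of_int l :: real\<bar> < 1"
      using i j unfolding kl[symmetric] by (auto simp: para_def inner_diff_right inner_add_right)
    then have "k = 0" "l = 0"
      by linarith+
    then show "i = j"
      using d by simp
  qed
qed

text \<open>The part of \<open>para\<close> with coordinate sum at most 1 is \<open>tri\<close>
  without \<open>a + u\<close> and \<open>a + v\<close>; the rest is \<open>tri_refl\<close>. These
  two vertices are lattice points, hence never hit by \<open>i + x\<close> when \<open>x\<close> is
  none.\<close>

lemma lattice_count_tri:
  assumes "x \<notin> Z2"
  shows "lattice_count tri x + lattice_count tri_refl x = lattice_count para x"
proof -
  have "tri \<inter> tri_refl = {}"
    by (auto simp: tri_def tri_refl_def)
  moreover have "{i \<in> Z2. i + x \<in> tri} \<union> {i \<in> Z2. i + x \<in> tri_refl} = {i \<in> Z2. i + x \<in> para}"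
  proof -
    have "i + x \<in> tri \<or> i + x \<in> tri_refl \<longleftrightarrow> i + x \<in> para" if "i \<in> Z2" for i
    proof -
      define z where "z = i + x"
      have "z \<notin> Z2"
        using Z2_diff[of z i] that assms by (auto simp: z_def)
      then have ne: "z \<noteq> a + u" "z \<noteq> a + v"
        using lattice Z2_add by auto
      have "\<not> (m \<bullet> (z - a) = 1 \<and> n \<bullet> (z - a) = 0)" "\<not> (m \<bullet> (z - a) = 0 \<and> n \<bullet> (z - a) = 1)"
        using ne coords_eqI[of "z - a" u] coords_eqI[of "z - a" v] by (auto simp: dual algebra_simps)
      then show ?thesis
        unfolding z_def[symmetric] by (auto simp: tri_def tri_refl_def para_def)
    qed
    then show ?thesis
      by auto
  qed
  ultimately show ?thesis
    unfolding lattice_count_def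
    by (subst card_Un_disjoint[symmetric])
      (auto intro!: finite_lattice_translate bounded_tri bounded_tri_refl)
qed

text \<open>Being constant, the count equals its mean over the cell of area 1, and that mean is the
  area of \<open>tri\<close> plus the equal area of \<open>tri_refl\<close>.\<close>

lemma lattice_count_para: "real (lattice_count para x) = 2 * measure lebesgue tri"
proof -
  have const: "lattice_count para z = lattice_count para x" for z
    by (intro antisym lattice_count_para_le)
  have "((\<lambda>z. real (lattice_count tri z) + real (lattice_count tri_refl z)) has_integral
      measure lebesgue tri + measure lebesgue tri_refl) unit_cell"
    by (intro has_integral_add lattice_count_has_integral tri_lmeasurable bounded_tri bounded_tri_refl)
  then have 1: "((\<lambda>z. real (lattice_count para x)) has_integral
      measure lebesgue tri + measure lebesgue tri_refl) unit_cell"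
  proof (rule has_integral_spike_finite[rotated 2])
    have "bounded unit_cell"
      using bounded_subset[OF bounded_cbox unit_cell_bounds(2)] .
    \<comment> \<open>The tiling identity \<open>lattice_count_tri\<close> is available off these
      points.\<close>
    then show "finite (Z2 \<inter> unit_cell)"
      by (rule finite_Z2_bounded)
    show "real (lattice_count para x) = real (lattice_count tri z) + real (lattice_count tri_refl z)"
      if "z \<in> unit_cell - Z2 \<inter> unit_cell" for z
      using that by (metis DiffE IntI const lattice_count_tri of_nat_add)
  qed
  have "((\<lambda>z. real (lattice_count para x) * 1) has_integral real (lattice_count para x) * measure lebesgue unit_cell) unit_cell"
    using unit_cell_lmeasurable
    by (intro has_integral_mult_right) (metis has_integral_integral lmeasurable_iff_integrable_on lmeasure_integral)
  then show ?thesis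
    using has_integral_unique[OF 1] by (simp add: measure_unit_cell measure_tri_refl)
qed

end

section \<open>Symmetries of the count, and segments through convex sets\<close>

lemma lattice_count_add_lattice:
  assumes "r \<in> Z2"
  shows "lattice_count S (x + r) = lattice_count S x"
  unfolding lattice_count_def
  by (rule bij_betw_same_card[of "\<lambda>i. i + r"], rule bij_betw_byWitness[where f' = "\<lambda>i. i - r"])
    (auto simp: Z2_add Z2_diff assms add_ac)

text \<open>Substitute \<open>c - i\<close> for \<open>i\<close>; this permutes Z^2 because
  \<open>c\<close> is a lattice point.\<close>

lemma lattice_count_reflect:
  assumes "c \<in> Z2"
  shows "lattice_count ((\<lambda>z. c - z) ` S) x = lattice_count S (- x)"
proof -
  have "i + x \<in> (\<lambda>z. c - z) ` S \<longleftrightarrow> c - i - x \<in> S" for i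
    by (auto simp: image_iff algebra_simps intro!: bexI[of _ "c - i - x"])
  then show ?thesis
    unfolding lattice_count_def
    by (intro bij_betw_same_card[of "\<lambda>i. c - i"] bij_betw_byWitness[where f' = "\<lambda>i. c - i"])
      (auto simp: Z2_diff assms)
qed

text \<open>A line cuts a convex set in an interval of parameters. This gives integrability along
  bonds and, later, a null set of exceptional parameters.\<close>

lemma convex_segment_preimage:
  fixes S :: "'a::real_vector set"
  assumes "convex S"
  shows "convex {l::real. x + l *\<^sub>R r \<in> S}"
proof (rule convexI)
  fix l k s t :: real
  assume l: "l \<in> {l. x + l *\<^sub>R r \<in> S}" and k: "k \<in> {l. x + l *\<^sub>R r \<in> S}"
    and st: "0 \<le> s" "0 \<le> t" "s + t = 1"
  have "x = s *\<^sub>R x + t *\<^sub>R x"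
    using st by (simp flip: scaleR_left_distrib)
  then have "x + (s *\<^sub>R l + t *\<^sub>R k) *\<^sub>R r = s *\<^sub>R (x + l *\<^sub>R r) + t *\<^sub>R (x + k *\<^sub>R r)"
    by (simp add: algebra_simps)
  then show "s *\<^sub>R l + t *\<^sub>R k \<in> {l. x + l *\<^sub>R r \<in> S}"
    using convexD[OF assms] l k st by simp
qed

lemma indicator_segment_integrable:
  fixes S :: "'a::real_vector set"
  assumes "convex S"
  shows "(\<lambda>l. indicator S (x + l *\<^sub>R r) :: real) integrable_on {0..1}"
proof -
  have "{l. x + l *\<^sub>R r \<in> S} \<inter> {0..1} \<in> lmeasurable"
    by (intro measurable_convex convex_Int bounded_Int convex_segment_preimage assms) auto
  then have "(indicator ({l. x + l *\<^sub>R r \<in> S} \<inter> {0..1}) :: real \<Rightarrow> real) integrable_on UNIV"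
    by (auto simp: lmeasurable_iff_has_integral)
  moreover have "indicator ({l. x + l *\<^sub>R r \<in> S} \<inter> {0..1}) = (\<lambda>l. if l \<in> {0..1} then indicator S (x + l *\<^sub>R r) else (0::real))"
    by (auto simp: indicator_def)
  ultimately show ?thesis
    by (simp only: integrable_restrict_UNIV)
qed

text \<open>Lattice points are the exceptions in \<open>lattice_count_tri\<close> and in the density
  formula for \<open>chi\<close>; along a bond they can be ignored in integrals.\<close>

lemma finite_lattice_on_segment:
  assumes "r \<noteq> 0"
  shows "finite {l \<in> {0..1::real}. x + l *\<^sub>R r \<in> Z2}"
proof -
  have "(\<lambda>l. x + l *\<^sub>R r) ` {l \<in> {0..1}. x + l *\<^sub>R r \<in> Z2} \<subseteq> Z2 \<inter> cball x (norm r)"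
    by (auto simp: dist_norm mult_left_le_one_le)
  then have "finite ((\<lambda>l. x + l *\<^sub>R r) ` {l \<in> {0..1}. x + l *\<^sub>R r \<in> Z2})"
    by (rule finite_subset) (intro finite_Z2_bounded bounded_cball)
  then show ?thesis
    by (rule finite_imageD) (use assms in \<open>auto simp: inj_on_def\<close>)
qed

text \<open>For a triangle S this is the density of S at x unless x is a vertex.\<close>
definition half_weight :: "pt set \<Rightarrow> pt \<Rightarrow> real" where
  "half_weight S x = (indicator S x + indicator (interior S) x) / 2"

lemma half_weight_segment_integrable:
  assumes "convex S"
  shows "(\<lambda>l. half_weight S (x + l *\<^sub>R r)) integrable_on {0..1}"
  unfolding half_weight_def
  by (intro integrable_on_divide integrable_add indicator_segment_integrable convex_interior assms)

context lattice_triangle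
begin

lemma lattice_count_tri_refl: "lattice_count tri_refl x = lattice_count (interior tri) (- x)"
proof -
  have "tri_refl = (\<lambda>z. (2 *\<^sub>R a + u + v) - z) ` interior tri"
    unfolding tri_refl_eq by (intro image_cong) auto
  \<comment> \<open>This vector is twice the centre of reflection; it, rather than the centre, has
    to be a lattice point.\<close>
  moreover have "2 *\<^sub>R a + u + v \<in> Z2"
    by (intro Z2_add Z2_scaleR lattice) auto
  ultimately show ?thesis
    by (simp add: lattice_count_reflect)
qed

text \<open>The finite \<open>J\<close> stands in for Z^2: by \<open>disj\<close> the open bonds
  starting elsewhere miss the triangle. The closed and the open triangle are counted separately, and
  \<open>half_weight\<close> is their mean.\<close>

lemma bond_density:
  assumes r: "r \<in> Z2" "r \<noteq> 0" and J: "finite J" "J \<subseteq> Z2"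
    and disj: "\<And>i. i \<in> Z2 \<Longrightarrow> i \<notin> J \<Longrightarrow> open_segment i (i + r) \<inter> tri = {}"
  shows "(\<Sum>i\<in>J. integral {0..1} (\<lambda>l. half_weight tri (i + l *\<^sub>R r))) = measure lebesgue tri"
proof -
  let ?f = "\<lambda>l. \<Sum>i\<in>J. indicator tri (i + l *\<^sub>R r) :: real"
  let ?g = "\<lambda>l. \<Sum>i\<in>J. indicator (interior tri) (i + l *\<^sub>R r) :: real"
  have int: "?f integrable_on {0..1}" "?g integrable_on {0..1}"
    by (intro integrable_sum J indicator_segment_integrable convex_interior convex_tri)+
  have mem: "i \<in> J" if "i \<in> Z2" "i + l *\<^sub>R r \<in> tri" "0 < l" "l < 1" for i l
  proof -
    have "i + l *\<^sub>R r \<in> open_segment i (i + r)"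
      using that r by (auto simp: in_segment algebra_simps intro!: exI[of _ l])
    then show ?thesis
      using disj that by blast
  qed
  have 1: "real (lattice_count tri (l *\<^sub>R r)) = ?f l" if "0 < l" "l < 1" for l
    by (rule lattice_count_eq_sum[OF J]) (use mem that in blast)
  \<comment> \<open>Reflection replaces l r by - l r, and adding the lattice vector \<open>r\<close>
    leads back to a point of the bond, (1 - l) r.\<close>
  have 2: "real (lattice_count tri_refl (l *\<^sub>R r)) = ?g (1 - l)" if "0 < l" "l < 1" for l
  proof -
    have "lattice_count tri_refl (l *\<^sub>R r) = lattice_count (interior tri) (- (l *\<^sub>R r) + r)"
      by (simp only: lattice_count_tri_refl lattice_count_add_lattice[OF r(1)])
    also have "- (l *\<^sub>R r) + r = (1 - l) *\<^sub>R r"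
      by (simp add: algebra_simps)
    finally have "real (lattice_count tri_refl (l *\<^sub>R r)) = real (lattice_count (interior tri) ((1 - l) *\<^sub>R r))"
      by simp
    also have "\<dots> = ?g (1 - l)"
      by (rule lattice_count_eq_sum[OF J]) (use mem[of _ "1 - l"] that interior_subset in force)
    finally show ?thesis .
  qed
  \<comment> \<open>Traversing the bonds backwards does not change the integral.\<close>
  have rev: "((\<lambda>l. ?g (1 - l)) has_integral integral {0..1} ?g) {0..1}"
    using has_integral_affinity01[OF integrable_integral[OF int(2)], of "-1" 1]
    by (simp add: algebra_simps)
  have "((\<lambda>l. ?f l + ?g (1 - l)) has_integral integral {0..1} ?f + integral {0..1} ?g) {0..1}"
    by (intro has_integral_add rev integrable_integral int)
  then have "((\<lambda>l::real. 2 * measure lebesgue tri) has_integral integral {0..1} ?f + integral {0..1} ?g) {0..1}"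
  proof (rule has_integral_spike_finite[rotated 2])
    \<comment> \<open>The end points 0 and 1 are excepted because \<open>disj\<close> concerns open
      segments, the other parameters because \<open>lattice_count_tri\<close> requires a point off
      Z^2.\<close>
    show "finite ({l \<in> {0..1}. 0 + l *\<^sub>R r \<in> Z2} \<union> {0, 1})"
      using finite_lattice_on_segment[OF r(2)] by blast
    fix l assume l: "l \<in> {0..1} - ({l \<in> {0..1}. 0 + l *\<^sub>R r \<in> Z2} \<union> {0, 1})"
    then have "0 < l" "l < 1" "l *\<^sub>R r \<notin> Z2"
      by auto
    then show "2 * measure lebesgue tri = ?f l + ?g (1 - l)"
      unfolding 1[OF \<open>0 < l\<close> \<open>l < 1\<close>, symmetric] 2[OF \<open>0 < l\<close> \<open>l < 1\<close>, symmetric]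
      by (metis lattice_count_para lattice_count_tri of_nat_add)
  qed
  moreover have "((\<lambda>l::real. 2 * measure lebesgue tri) has_integral 2 * measure lebesgue tri) {0..1}"
    using has_integral_const_real[of "2 * measure lebesgue tri" 0 1] by simp
  ultimately have "integral {0..1} ?f + integral {0..1} ?g = 2 * measure lebesgue tri"
    by (rule has_integral_unique)
  moreover have "(\<Sum>i\<in>J. integral {0..1} (\<lambda>l. half_weight tri (i + l *\<^sub>R r))) = (integral {0..1} ?f + integral {0..1} ?g) / 2"
  proof -
    have "integral {0..1} (\<lambda>l. half_weight tri (i + l *\<^sub>R r)) =
      (integral {0..1} (\<lambda>l. indicator tri (i + l *\<^sub>R r)) + integral {0..1} (\<lambda>l. indicator (interior tri) (i + l *\<^sub>R r))) / 2" for i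
      unfolding half_weight_def
      by (subst integral_add[symmetric]) (auto intro!: indicator_segment_integrable convex_interior convex_tri)
    then have "(\<Sum>i\<in>J. integral {0..1} (\<lambda>l. half_weight tri (i + l *\<^sub>R r))) =
      ((\<Sum>i\<in>J. integral {0..1} (\<lambda>l. indicator tri (i + l *\<^sub>R r))) +
       (\<Sum>i\<in>J. integral {0..1} (\<lambda>l. indicator (interior tri) (i + l *\<^sub>R r)))) / 2"
      by (simp only: sum.distrib flip: sum_divide_distrib)
    then show ?thesis
      by (simp add: integral_sum J indicator_segment_integrable convex_interior convex_tri)
  qed
  ultimately show ?thesis
    by simp
qed

end

section \<open>Densities\<close>

text \<open>Reflection in \<open>x\<close> exchanges the two closed halves of the ball, which cover
  it and overlap in part of a hyperplane.\<close>

lemma measure_half_ball: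
  fixes x k :: "'a::euclidean_space"
  assumes "k \<noteq> 0"
  shows "measure lebesgue ({z. 0 \<le> k \<bullet> (z - x)} \<inter> ball x \<rho>) = measure lebesgue (ball x \<rho>) / 2"
proof -
  let ?A = "{z. 0 \<le> k \<bullet> (z - x)} \<inter> ball x \<rho>" and ?B = "{z. k \<bullet> (z - x) \<le> 0} \<inter> ball x \<rho>"
  have "z \<in> ?B \<longleftrightarrow> 2 *\<^sub>R x - z \<in> ?A" for z
    by (auto simp: dist_norm inner_diff_right scaleR_2 norm_minus_commute algebra_simps)
  then have "?B = (\<lambda>z. (- 1) *\<^sub>R z + 2 *\<^sub>R x) ` ?A"
    by (force simp: image_iff)
  then have B: "measure lebesgue ?B = measure lebesgue ?A"
    by (simp only: measure_lebesgue_affine) simp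
  have hs: "{z. 0 \<le> k \<bullet> (z - x)} = {z. k \<bullet> z \<ge> k \<bullet> x}" "{z. k \<bullet> (z - x) \<le> 0} = {z. k \<bullet> z \<le> k \<bullet> x}"
    by (auto simp: inner_diff_right)
  have meas: "?A \<in> lmeasurable" "?B \<in> lmeasurable"
    unfolding hs
    by (auto intro!: measurable_convex convex_Int convex_halfspace_ge convex_halfspace_le bounded_Int)
  have "?A \<inter> ?B \<subseteq> {z. k \<bullet> z = k \<bullet> x}"
    by (auto simp: inner_diff_right)
  then have "negligible (?A \<inter> ?B)"
    by (rule negligible_subset[rotated]) (rule negligible_hyperplane, use assms in simp)
  then have "measure lebesgue (?A \<union> ?B) = measure lebesgue ?A + measure lebesgue ?B"
    by (simp only: measure_Un3[OF meas] negligible_imp_measure0 diff_0_right)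
  moreover have "?A \<union> ?B = ball x \<rho>"
    by auto
  ultimately have "measure lebesgue (ball x \<rho>) = measure lebesgue ?A + measure lebesgue ?B"
    by (simp only:)
  then show ?thesis
    using B by simp
qed

text \<open>Unlike \<open>Lim\<close> in \<open>chi\<close>, this asserts convergence, so that
  densities can be added over triangles.\<close>

definition has_density :: "pt set \<Rightarrow> pt \<Rightarrow> real \<Rightarrow> bool" where
  "has_density S x d \<longleftrightarrow>
     ((\<lambda>\<rho>. measure lebesgue (S \<inter> ball x \<rho>) / measure lebesgue (ball x \<rho>)) \<longlongrightarrow> d) (at_right 0)"

text \<open>Away from its vertices a triangle is locally empty, full or a half-space, so the
  quotient is constant for small radii.\<close>

lemma has_densityI:
  assumes "open U" "x \<in> U"
    and "\<And>\<rho>. 0 < \<rho> \<Longrightarrow> ball x \<rho> \<subseteq> U \<Longrightarrow> measure lebesgue (S \<inter> ball x \<rho>) = d * measure lebesgue (ball x \<rho>)"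
  shows "has_density S x d"
proof -
  obtain e where e: "e > 0" "ball x e \<subseteq> U"
    using assms openE by blast
  have "measure lebesgue (S \<inter> ball x \<rho>) / measure lebesgue (ball x \<rho>) = d" if "0 < \<rho>" "\<rho> < e" for \<rho>
  proof -
    have "ball x \<rho> \<subseteq> U"
      using e that by (meson less_imp_le order_trans subset_ball)
    then show ?thesis
      using assms(3)[of \<rho>] that content_ball_pos[of \<rho> x] by (simp add: measure_completion)
  qed
  then have "eventually (\<lambda>\<rho>. measure lebesgue (S \<inter> ball x \<rho>) / measure lebesgue (ball x \<rho>) = d) (at_right 0)"
    using e(1) by (auto simp: eventually_at_right_field)
  then show ?thesis
    unfolding has_density_def by (rule tendsto_eventually)
qed

lemma has_density_halfspace:
  assumes "open U" "x \<in> U" "k \<noteq> 0" "S \<inter> U = {z. 0 \<le> k \<bullet> (z - x)} \<inter> U"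
  shows "has_density S x (1/2)"
proof (rule has_densityI[OF assms(1,2)])
  fix \<rho> :: real assume "ball x \<rho> \<subseteq> U"
  then have "S \<inter> ball x \<rho> = {z. 0 \<le> k \<bullet> (z - x)} \<inter> ball x \<rho>"
    using assms(4) by blast
  then show "measure lebesgue (S \<inter> ball x \<rho>) = 1/2 * measure lebesgue (ball x \<rho>)"
    by (simp only: measure_half_ball[OF assms(3)])
qed

context lattice_triangle
begin

lemma closed_tri: "closed tri"
  unfolding tri_def by (intro closed_Collect_conj closed_Collect_le continuous_intros)

text \<open>At a vertex the density is the angle divided by 2 pi, which is below the value 1/2 of
  \<open>half_weight\<close>; hence the exclusion.\<close>

lemma has_density_tri:
  assumes "x \<notin> {a, a + u, a + v}"
  shows "has_density tri x (half_weight tri x)"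
proof -
  consider "x \<notin> tri" | "x \<in> interior tri" | "x \<in> tri" "x \<notin> interior tri"
    by blast
  then show ?thesis
  proof cases
    case 1
    then have "half_weight tri x = 0"
      using interior_subset[of tri] by (auto simp: half_weight_def indicator_def)
    moreover have "has_density tri x 0"
    proof (rule has_densityI[of "- tri"])
      fix \<rho> :: real assume "ball x \<rho> \<subseteq> - tri"
      then have "tri \<inter> ball x \<rho> = {}"
        by blast
      then show "measure lebesgue (tri \<inter> ball x \<rho>) = 0 * measure lebesgue (ball x \<rho>)"
        by simp
    qed (use 1 closed_tri in auto)
    ultimately show ?thesis
      by simp
  next
    case 2
    then have "half_weight tri x = 1"
      using interior_subset[of tri] by (auto simp: half_weight_def indicator_def)
    moreover have "has_density tri x 1"
    proof (rule has_densityI[of "interior tri"])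
      fix \<rho> :: real assume "ball x \<rho> \<subseteq> interior tri"
      then have "tri \<inter> ball x \<rho> = ball x \<rho>"
        using interior_subset[of tri] by blast
      then show "measure lebesgue (tri \<inter> ball x \<rho>) = 1 * measure lebesgue (ball x \<rho>)"
        by simp
    qed (use 2 in auto)
    ultimately show ?thesis
      by simp
  next
    case 3
    then have hw: "half_weight tri x = 1/2"
      by (auto simp: half_weight_def)
    let ?s = "m \<bullet> (x - a)" and ?t = "n \<bullet> (x - a)"
    have nonneg: "0 \<le> ?s" "0 \<le> ?t" "?s + ?t \<le> 1"
      using 3 by (auto simp: tri_def)
    have vert: "\<not> (?s = 0 \<and> ?t = 0)" "\<not> (?s = 1 \<and> ?t = 0)" "\<not> (?s = 0 \<and> ?t = 1)"
      using assms coords_eqI[of "x - a" 0] coords_eqI[of "x - a" u] coords_eqI[of "x - a" v]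
      by (auto simp: dual algebra_simps)
    \<comment> \<open>Off the interior some barycentric coordinate vanishes, and off the vertices
      only one does. The other two stay positive near \<open>x\<close>, where \<open>tri\<close>
      therefore agrees with a half-space.\<close>
    consider "?s = 0" "0 < ?t" "?s + ?t < 1" | "?t = 0" "0 < ?s" "?s + ?t < 1"
      | "?s + ?t = 1" "0 < ?s" "0 < ?t"
      using 3 nonneg vert by (force simp: interior_tri)
    then have "has_density tri x (1/2)"
    proof cases
      case 1
      show ?thesis
      proof (rule has_density_halfspace[of "{z. 0 < n \<bullet> (z - a) \<and> m \<bullet> (z - a) + n \<bullet> (z - a) < 1}" x m])
        have "m \<bullet> (z - x) = m \<bullet> (z - a)" for z
          using 1 by (simp add: inner_diff_right)
        then show "tri \<inter> {z. 0 < n \<bullet> (z - a) \<and> m \<bullet> (z - a) + n \<bullet> (z - a) < 1} =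
            {z. 0 \<le> m \<bullet> (z - x)} \<inter> {z. 0 < n \<bullet> (z - a) \<and> m \<bullet> (z - a) + n \<bullet> (z - a) < 1}"
          by (auto simp: tri_def)
      qed (use 1 mn_nonzero in \<open>auto intro!: open_Collect_conj open_Collect_less continuous_intros\<close>)
    next
      case 2
      show ?thesis
      proof (rule has_density_halfspace[of "{z. 0 < m \<bullet> (z - a) \<and> m \<bullet> (z - a) + n \<bullet> (z - a) < 1}" x n])
        have "n \<bullet> (z - x) = n \<bullet> (z - a)" for z
          using 2 by (simp add: inner_diff_right)
        then show "tri \<inter> {z. 0 < m \<bullet> (z - a) \<and> m \<bullet> (z - a) + n \<bullet> (z - a) < 1} =
            {z. 0 \<le> n \<bullet> (z - x)} \<inter> {z. 0 < m \<bullet> (z - a) \<and> m \<bullet> (z - a) + n \<bullet> (z - a) < 1}"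
          by (auto simp: tri_def)
      qed (use 2 mn_nonzero in \<open>auto intro!: open_Collect_conj open_Collect_less continuous_intros\<close>)
    next
      case 3
      show ?thesis
      proof (rule has_density_halfspace[of "{z. 0 < m \<bullet> (z - a) \<and> 0 < n \<bullet> (z - a)}" x "- (m + n)"])
        have "- (m + n) \<bullet> (z - x) = 1 - (m \<bullet> (z - a) + n \<bullet> (z - a))" for z
          using 3 unfolding inner_minus_left inner_add_left by (simp add: inner_diff_right)
        then show "tri \<inter> {z. 0 < m \<bullet> (z - a) \<and> 0 < n \<bullet> (z - a)} =
            {z. 0 \<le> - (m + n) \<bullet> (z - x)} \<inter> {z. 0 < m \<bullet> (z - a) \<and> 0 < n \<bullet> (z - a)}"
          by (auto simp: tri_def)
        show "- (m + n) \<noteq> 0"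
          using mn_nonzero by (simp only: neg_equal_0_iff_equal not_False_eq_True)
      qed (use 3 in \<open>auto intro!: open_Collect_conj open_Collect_less continuous_intros\<close>)
    qed
    then show ?thesis
      by (simp only: hw)
  qed
qed

end

section \<open>Triangulations by lattice triangles\<close>

lemma lattice_triangle_exists:
  assumes "card V = 3" "V \<subseteq> Z2" "\<not> collinear V"
  obtains a u v m n where "lattice_triangle a u v m n" "V = {a, a + u, a + v}"
    "convex hull V = lattice_triangle.tri a m n"
proof -
  obtain a b c where V: "V = {a, b, c}" and ne: "a \<noteq> b" "a \<noteq> c" "b \<noteq> c"
    using assms(1) by (auto simp: card_3_iff)
  define u v where "u = b - a" and "v = c - a"
  \<comment> \<open>The determinant of the matrix with columns \<open>u\<close> and
    \<open>v\<close>. By Cramer's rule the rows of the inverse matrix are the dual basis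
    \<open>m\<close>, \<open>n\<close>.\<close>
  define d where "d = u$1 * v$2 - u$2 * v$1"
  define m n :: pt where "m = vector [v$2 / d, - v$1 / d]" and "n = vector [- u$2 / d, u$1 / d]"
  have "d \<noteq> 0"
  proof
    assume "d = 0"
    \<comment> \<open>A nonzero component of \<open>u\<close> provides the factor that makes
      \<open>v\<close> a multiple of \<open>u\<close>.\<close>
    have "collinear {0, u, v}"
    proof (cases "u$1 = 0")
      case True
      moreover have "u$2 \<noteq> 0"
        using True ne by (auto simp: u_def vec_eq_iff forall_2)
      ultimately have "v = (v$2 / u$2) *\<^sub>R u"
        using \<open>d = 0\<close> by (auto simp: d_def vec_eq_iff forall_2)
      then show ?thesis
        unfolding collinear_lemma by blast
    next
      case False
      then have "v = (v$1 / u$1) *\<^sub>R u"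
        using \<open>d = 0\<close> by (auto simp: d_def vec_eq_iff forall_2 field_simps)
      then show ?thesis
        unfolding collinear_lemma by blast
    qed
    then have "collinear {b, a, c}"
      using collinear_3[of b a c] by (simp add: u_def v_def)
    then show False
      using assms(3) by (simp add: V insert_commute)
  qed
  have inner: "m \<bullet> z = (v$2 * z$1 - v$1 * z$2) / d" "n \<bullet> z = (u$1 * z$2 - u$2 * z$1) / d" for z
    by (simp_all add: m_def n_def inner_vec_def sum_2 diff_divide_distrib)
  interpret lattice_triangle a u v m n
  proof
    show "a \<in> Z2" "u \<in> Z2" "v \<in> Z2"
      using assms(2) by (auto simp: V u_def v_def intro: Z2_diff)
    show "m \<bullet> u = 1" "m \<bullet> v = 0" "n \<bullet> u = 0" "n \<bullet> v = 1"
      using \<open>d \<noteq> 0\<close> by (simp_all add: inner d_def mult.commute)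
    fix z
    have eq: "d * z$k = (v$2 * z$1 - v$1 * z$2) * u$k + (u$1 * z$2 - u$2 * z$1) * v$k" for k
      using exhaust_2[of k] by (auto simp: d_def algebra_simps)
    have "z$k = ((m \<bullet> z) *\<^sub>R u + (n \<bullet> z) *\<^sub>R v) $ k" for k
    proof -
      have "z$k = d * z$k / d"
        using \<open>d \<noteq> 0\<close> by simp
      also have "\<dots> = ((m \<bullet> z) *\<^sub>R u + (n \<bullet> z) *\<^sub>R v) $ k"
        by (simp add: eq inner add_divide_distrib)
      finally show ?thesis .
    qed
    then show "z = (m \<bullet> z) *\<^sub>R u + (n \<bullet> z) *\<^sub>R v"
      by (simp add: vec_eq_iff)
  qed
  have "convex hull V = tri"
  proof (intro set_eqI iffI)
    fix z assume "z \<in> convex hull V"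
    then obtain s t where "z = a + s *\<^sub>R u + t *\<^sub>R v" "0 \<le> s" "0 \<le> t" "s + t \<le> 1"
      by (auto simp: V convex_hull_3_alt u_def v_def)
    then show "z \<in> tri"
      by (simp add: tri_def inner_add_right dual)
  next
    fix z assume "z \<in> tri"
    moreover have "z = a + (m \<bullet> (z - a)) *\<^sub>R u + (n \<bullet> (z - a)) *\<^sub>R v"
      using expand[of "z - a"] by (simp add: algebra_simps)
    ultimately show "z \<in> convex hull V"
      unfolding V convex_hull_3_alt u_def[symmetric] v_def[symmetric] by (auto simp: tri_def)
  qed
  moreover have "V = {a, a + u, a + v}"
    by (simp add: V u_def v_def)
  ultimately show ?thesis
    using that lattice_triangle_axioms by blast
qed

lemma chi_eqI: "has_density S x d \<Longrightarrow> chi S x = d"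
  unfolding chi_def has_density_def by (rule tendsto_Lim) auto

lemma lattice_triangulationE:
  assumes "lattice_triangulation Tr S" "V \<in> Tr"
  obtains a u v m n where "lattice_triangle a u v m n" "V = {a, a + u, a + v}"
    "convex hull V = lattice_triangle.tri a m n"
  using lattice_triangle_exists assms unfolding lattice_triangulation_def by metis

text \<open>By conformity the intersection is the hull of at most two points; a convex set with
  empty interior is a null set.\<close>

lemma lattice_triangulation_overlap:
  assumes "lattice_triangulation Tr S" "V \<in> Tr" "W \<in> Tr" "V \<noteq> W"
  shows "negligible (convex hull V \<inter> convex hull W)"
proof -
  have card: "card V = 3" "card W = 3"
    and eq: "convex hull V \<inter> convex hull W = convex hull (V \<inter> W)"
    using assms by (auto simp: lattice_triangulation_def)
  have fin: "finite V" "finite W"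
    using card by (auto intro: card_ge_0_finite)
  have "V \<inter> W \<subset> V"
    using card_subset_eq[OF fin(2), of V] card assms(4) by auto
  then have "card (V \<inter> W) < 3"
    using psubset_card_mono[OF fin(1)] card by simp
  then have "interior (convex hull (V \<inter> W)) = {}"
    using fin by (intro empty_interior_convex_hull) auto
  then show ?thesis
    unfolding eq by (simp add: negligible_convex_interior)
qed

text \<open>The interior of each triangle lies in \<open>interior (closure \<omega>)\<close>, which
  is \<open>\<omega>\<close>, so the points in question lie on triangle frontiers. Thus
  \<open>\<omega>\<close> has the same densities as its closure, the set covered by the
  triangles.\<close>

lemma negligible_closure_diff_polygon:
  assumes "lattice_triangulation Tr (closure \<omega>)" "\<omega> = interior (closure \<omega>)"
  shows "negligible (closure \<omega> - \<omega>)"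
proof (rule negligible_subset)
  show "negligible (\<Union>V\<in>Tr. frontier (convex hull V))"
    using assms(1) by (intro negligible_Union) (auto simp: lattice_triangulation_def negligible_convex_frontier)
  have U: "(\<Union>V\<in>Tr. convex hull V) = closure \<omega>"
    using assms(1) by (auto simp: lattice_triangulation_def)
  show "closure \<omega> - \<omega> \<subseteq> (\<Union>V\<in>Tr. frontier (convex hull V))"
  proof
    fix x assume x: "x \<in> closure \<omega> - \<omega>"
    then obtain V where V: "V \<in> Tr" "x \<in> convex hull V"
      using U by blast
    moreover have "x \<notin> interior (convex hull V)"
      using x V(1) U assms(2) interior_mono[of "convex hull V" "closure \<omega>"] by blast
    ultimately show "x \<in> (\<Union>V\<in>Tr. frontier (convex hull V))"
      using closure_subset by (auto simp: frontier_def)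
  qed
qed

text \<open>Overlaps of triangles and the boundary of \<open>\<omega>\<close> are null sets, so in
  every ball the measure is additive over the triangles. The assumption on \<open>x\<close> keeps it
  away from all vertices.\<close>

lemma chi_eq_sum_half_weight:
  assumes tri: "lattice_triangulation Tr (closure \<omega>)" and reg: "\<omega> = interior (closure \<omega>)"
    and x: "x \<notin> Z2"
  shows "chi \<omega> x = (\<Sum>V\<in>Tr. half_weight (convex hull V) x)"
proof (rule chi_eqI)
  have fin: "finite Tr" and U: "(\<Union>V\<in>Tr. convex hull V) = closure \<omega>"
    using tri by (auto simp: lattice_triangulation_def)
  have "has_density (convex hull V) x (half_weight (convex hull V) x)" if V: "V \<in> Tr" for V
  proof -
    obtain a u v m n where T: "lattice_triangle a u v m n" "V = {a, a + u, a + v}"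
      "convex hull V = lattice_triangle.tri a m n"
      using lattice_triangulationE[OF tri V] .
    have "V \<subseteq> Z2"
      using tri V by (auto simp: lattice_triangulation_def)
    then have "x \<notin> {a, a + u, a + v}"
      using x T(2) by blast
    then show ?thesis
      unfolding T(3) by (rule lattice_triangle.has_density_tri[OF T(1)])
  qed
  then have "((\<lambda>\<rho>. \<Sum>V\<in>Tr. measure lebesgue (convex hull V \<inter> ball x \<rho>) / measure lebesgue (ball x \<rho>))
      \<longlongrightarrow> (\<Sum>V\<in>Tr. half_weight (convex hull V) x)) (at_right 0)"
    unfolding has_density_def by (intro tendsto_sum) blast
  moreover have "(\<Sum>V\<in>Tr. measure lebesgue (convex hull V \<inter> ball x \<rho>) / measure lebesgue (ball x \<rho>))
      = measure lebesgue (\<omega> \<inter> ball x \<rho>) / measure lebesgue (ball x \<rho>)" for \<rho>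
  proof -
    have meas: "convex hull V \<inter> ball x \<rho> \<in> lmeasurable" for V
      by (intro measurable_convex convex_Int bounded_Int) auto
    have "measure lebesgue (\<Union>V\<in>Tr. convex hull V \<inter> ball x \<rho>) = (\<Sum>V\<in>Tr. measure lebesgue (convex hull V \<inter> ball x \<rho>))"
    proof (rule measure_negligible_finite_Union_image[OF fin meas])
      show "pairwise (\<lambda>V W. negligible (convex hull V \<inter> ball x \<rho> \<inter> (convex hull W \<inter> ball x \<rho>))) Tr"
      proof (rule pairwiseI)
        fix V W assume "V \<in> Tr" "W \<in> Tr" "V \<noteq> W"
        then show "negligible (convex hull V \<inter> ball x \<rho> \<inter> (convex hull W \<inter> ball x \<rho>))"
          by (rule negligible_subset[OF lattice_triangulation_overlap[OF tri]]) auto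
      qed
    qed
    moreover have "(\<Union>V\<in>Tr. convex hull V \<inter> ball x \<rho>) = closure \<omega> \<inter> ball x \<rho>"
      using U by blast
    moreover have "measure lebesgue (closure \<omega> \<inter> ball x \<rho>) = measure lebesgue (\<omega> \<inter> ball x \<rho>)"
    proof (rule measure_negligible_symdiff)
      have "open \<omega>"
        using reg open_interior[of "closure \<omega>"] by simp
      then show "\<omega> \<inter> ball x \<rho> \<in> lmeasurable"
        by (intro lmeasurable_open bounded_Int open_Int) auto
      show "negligible (\<omega> \<inter> ball x \<rho> - closure \<omega> \<inter> ball x \<rho> \<union> (closure \<omega> \<inter> ball x \<rho> - \<omega> \<inter> ball x \<rho>))"
        by (rule negligible_subset[OF negligible_closure_diff_polygon[OF tri reg]])
          (use closure_subset[of \<omega>] in blast)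
    qed
    ultimately show ?thesis
      by (simp flip: sum_divide_distrib)
  qed
  ultimately show "has_density \<omega> x (\<Sum>V\<in>Tr. half_weight (convex hull V) x)"
    by (simp add: has_density_def)
qed

section \<open>Bond integrals\<close>

text \<open>Only points on the line through \<open>x\<close> in direction \<open>r\<close> have to
  lie in \<open>S\<close>; this admits points on an edge parallel to \<open>r\<close>.\<close>

lemma Dr_affine:
  assumes "linear A" "\<And>x. x \<in> S \<Longrightarrow> y x = A x + c"
    and "e > 0" "\<And>\<epsilon>. \<bar>\<epsilon>\<bar> < e \<Longrightarrow> x + \<epsilon> *\<^sub>R r \<in> S"
  shows "Dr y r x = A r"
proof -
  have "(y (x + \<epsilon> *\<^sub>R r) - y x) /\<^sub>R \<epsilon> = A r" if "\<epsilon> \<noteq> 0" "\<bar>\<epsilon>\<bar> < e" for \<epsilon>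
    using assms(2)[OF assms(4), of \<epsilon>] assms(2)[OF assms(4), of 0] that assms(3)
    by (simp add: linear_add[OF assms(1)] linear_scale[OF assms(1)])
  then have "eventually (\<lambda>\<epsilon>. (y (x + \<epsilon> *\<^sub>R r) - y x) /\<^sub>R \<epsilon> = A r) (at 0)"
    using assms(3) by (auto simp: eventually_at)
  then show ?thesis
    unfolding Dr_def by (intro tendsto_Lim tendsto_eventually) auto
qed

text \<open>A nonempty interior leaves the \<open>SOME\<close> in \<open>DrT\<close> a single
  possible value.\<close>

lemma DrT_affine:
  assumes "linear A" "\<And>x. x \<in> convex hull V \<Longrightarrow> y x = A x + c" "interior (convex hull V) \<noteq> {}"
  shows "DrT y r V = A r"
proof -
  have D: "Dr y r x = A r" if x: "x \<in> interior (convex hull V)" for x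
  proof -
    have "((\<lambda>\<epsilon>. x + \<epsilon> *\<^sub>R r) \<longlongrightarrow> x + 0 *\<^sub>R r) (at 0)"
      by (intro tendsto_intros)
    then have "eventually (\<lambda>\<epsilon>. x + \<epsilon> *\<^sub>R r \<in> interior (convex hull V)) (at 0)"
      by (rule topological_tendstoD) (use x in auto)
    then obtain e where "e > 0" "\<And>\<epsilon>. \<epsilon> \<noteq> 0 \<Longrightarrow> \<bar>\<epsilon>\<bar> < e \<Longrightarrow> x + \<epsilon> *\<^sub>R r \<in> interior (convex hull V)"
      by (auto simp: eventually_at dist_real_def)
    then have "e > 0" "\<And>\<epsilon>. \<bar>\<epsilon>\<bar> < e \<Longrightarrow> x + \<epsilon> *\<^sub>R r \<in> interior (convex hull V)"
      using x by (metis add.right_neutral scaleR_zero_left)+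
    then show ?thesis
      using interior_subset by (intro Dr_affine[OF assms(1,2), where e = e]) auto
  qed
  with assms(3) show ?thesis
    unfolding DrT_def by (intro some_equality) auto
qed

text \<open>Off the finitely many endpoints of the sets \<open>{l. i + l r \<in> T}\<close> the difference quotient in
  direction r stays inside each triangle containing the point. Hence \<open>Dr\<close> exists there even on
  edges parallel to r, where y need not be differentiable.\<close>
lemma c_bond_eq_sum:
  assumes tri: "lattice_triangulation Tr (closure \<omega>)" and reg: "\<omega> = interior (closure \<omega>)"
    and P1: "P1 Tr (closure \<omega>) y" and "r \<noteq> 0"
  shows "c_bond \<phi> \<omega> y (i, r) =
    (\<Sum>V\<in>Tr. phi \<phi> (DrT y r V) * integral {0..1} (\<lambda>l. half_weight (convex hull V) (i + l *\<^sub>R r)))"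
proof -
  have fin: "finite Tr"
    using tri by (auto simp: lattice_triangulation_def)
  \<comment> \<open>The parameter interval on which the line runs in the triangle; its frontier
    consists of the parameters of entry and exit.\<close>
  define K where "K V = {l. i + l *\<^sub>R r \<in> convex hull V}" for V
  have front: "negligible (frontier (K V))" for V
    unfolding K_def by (intro negligible_convex_frontier convex_segment_preimage) simp
  define N where "N = {l \<in> {0..1}. i + l *\<^sub>R r \<in> Z2} \<union> (\<Union>V\<in>Tr. frontier (K V))"
  have "negligible N"
    unfolding N_def using fin finite_lattice_on_segment[OF \<open>r \<noteq> 0\<close>]
    by (intro negligible_Un negligible_Union) (auto intro: front simp del: atLeastAtMost_iff)
  moreover have "(if chi \<omega> x = 0 then 0 else chi \<omega> x * phi \<phi> (Dr y r x)) =
      (\<Sum>V\<in>Tr. phi \<phi> (DrT y r V) * half_weight (convex hull V) x)"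
    if l: "l \<in> {0..1} - N" and x: "x = i + l *\<^sub>R r" for l x
  proof -
    \<comment> \<open>Triangles not containing \<open>x\<close> have weight 0. For all others, even
      for two sharing an edge along the bond, the one value \<open>Dr y r x\<close> equals
      \<open>DrT y r V\<close>.\<close>
    have "half_weight (convex hull V) x * phi \<phi> (Dr y r x) = phi \<phi> (DrT y r V) * half_weight (convex hull V) x"
      if V: "V \<in> Tr" for V
    proof (cases "x \<in> convex hull V")
      case True
      obtain A c where A: "linear A" "\<And>x. x \<in> convex hull V \<Longrightarrow> y x = A x + c"
        using P1 V unfolding P1_def by blast
      have "l \<in> K V" "l \<notin> frontier (K V)"
        using True l V by (auto simp: K_def N_def x)
      then have "l \<in> interior (K V)"
        using closure_subset by (auto simp: frontier_def)
      then obtain e where e: "e > 0" "ball l e \<subseteq> K V"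
        by (auto simp: mem_interior)
      have "x + \<epsilon> *\<^sub>R r \<in> convex hull V" if "\<bar>\<epsilon>\<bar> < e" for \<epsilon>
      proof -
        have "l + \<epsilon> \<in> K V"
          using e that by (auto simp: dist_real_def)
        then show ?thesis
          by (simp add: K_def x algebra_simps)
      qed
      then have "Dr y r x = A r"
        using e(1) by (intro Dr_affine[OF A])
      moreover have "DrT y r V = A r"
      proof (rule DrT_affine[OF A])
        obtain a u v m n where T: "lattice_triangle a u v m n" "convex hull V = lattice_triangle.tri a m n"
          using lattice_triangulationE[OF tri V] .
        show "interior (convex hull V) \<noteq> {}"
          unfolding T(2) by (rule lattice_triangle.interior_tri_nonempty[OF T(1)])
      qed
      ultimately show ?thesis
        by simp
    next
      case False
      then show ?thesis
        using interior_subset[of "convex hull V"] by (auto simp: half_weight_def indicator_def)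
    qed
    then have "(\<Sum>V\<in>Tr. half_weight (convex hull V) x) * phi \<phi> (Dr y r x) =
        (\<Sum>V\<in>Tr. phi \<phi> (DrT y r V) * half_weight (convex hull V) x)"
      unfolding sum_distrib_right by (rule sum.cong[OF refl])
    moreover have "chi \<omega> x = (\<Sum>V\<in>Tr. half_weight (convex hull V) x)"
      using l by (intro chi_eq_sum_half_weight[OF tri reg]) (auto simp: N_def x)
    ultimately have "chi \<omega> x * phi \<phi> (Dr y r x) = (\<Sum>V\<in>Tr. phi \<phi> (DrT y r V) * half_weight (convex hull V) x)"
      by simp
    \<comment> \<open>The case distinction on \<open>chi\<close> is harmless: where it vanishes, so
      does the product.\<close>
    then show ?thesis
      by auto
  qed
  moreover have "(1 - l) *\<^sub>R i + l *\<^sub>R (i + r) = i + l *\<^sub>R r" for l :: real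
    by (simp add: algebra_simps)
  ultimately have "c_bond \<phi> \<omega> y (i, r) =
      integral {0..1} (\<lambda>l. \<Sum>V\<in>Tr. phi \<phi> (DrT y r V) * half_weight (convex hull V) (i + l *\<^sub>R r))"
    unfolding c_bond_def bond_avg_def by (auto intro!: integral_spike[of N])
  also have "\<dots> = (\<Sum>V\<in>Tr. phi \<phi> (DrT y r V) * integral {0..1} (\<lambda>l. half_weight (convex hull V) (i + l *\<^sub>R r)))"
    by (subst integral_sum[OF fin])
      (auto intro!: integrable_on_mult_right half_weight_segment_integrable)
  finally show ?thesis .
qed

text \<open>Exchanging the sums over bonds and triangles leaves, for each direction and triangle, a
  sum of segment averages that \<open>bond_density\<close> evaluates.\<close>

lemma sum_c_bond:
  assumes tri: "lattice_triangulation Tr (closure \<omega>)" and reg: "\<omega> = interior (closure \<omega>)"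
    and P1: "P1 Tr (closure \<omega>) y"
    and R: "finite R" "R \<subseteq> Z2 - {0}" and A2: "A2 \<Omega> \<omega> R" and "bounded \<Omega>"
  shows "finite (bonds \<Omega> R)" "(\<Sum>b\<in>bonds \<Omega> R. c_bond \<phi> \<omega> y b) = E_c \<phi> Tr R y"
proof -
  define J where "J r = {i \<in> lattice_pts \<Omega>. i + r \<in> lattice_pts \<Omega>}" for r
  have "finite (lattice_pts \<Omega>)"
    using finite_Z2_bounded[OF \<open>bounded \<Omega>\<close>] by (simp add: lattice_pts_def Int_commute)
  then have finJ: "finite (J r)" for r
    by (simp add: J_def)
  \<comment> \<open>The swap puts the direction first, so that the sets \<open>J r\<close> of
    starting points become fibres over \<open>R\<close>.\<close>
  have bonds: "bonds \<Omega> R = prod.swap ` Sigma R J"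
    by (auto simp: bonds_def J_def image_iff)
  then show "finite (bonds \<Omega> R)"
    using R finJ by simp
  have fin: "finite Tr" and U: "(\<Union>V\<in>Tr. convex hull V) = closure \<omega>"
    using tri by (auto simp: lattice_triangulation_def)
  have dens: "(\<Sum>i\<in>J r. integral {0..1} (\<lambda>l. half_weight (convex hull V) (i + l *\<^sub>R r))) = measure lebesgue (convex hull V)"
    if r: "r \<in> R" and V: "V \<in> Tr" for r V
  proof -
    obtain a u v m n where T: "lattice_triangle a u v m n" "convex hull V = lattice_triangle.tri a m n"
      using lattice_triangulationE[OF tri V] .
    show ?thesis
      unfolding T(2)
    proof (rule lattice_triangle.bond_density[OF T(1)])
      show "J r \<subseteq> Z2"
        by (auto simp: J_def lattice_pts_def)
      \<comment> \<open>Contrapositive of \<open>A2\<close>: a segment that is not a bond misses the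
        closure of \<open>\<omega>\<close>, which contains the triangle.\<close>
      show "open_segment i (i + r) \<inter> lattice_triangle.tri a m n = {}" if "i \<in> Z2" "i \<notin> J r" for i
        using A2 r that V U unfolding A2_def T(2)[symmetric] J_def by blast
    qed (use R r finJ in auto)
  qed
  have "(\<Sum>b\<in>bonds \<Omega> R. c_bond \<phi> \<omega> y b) = (\<Sum>(r, i)\<in>Sigma R J. c_bond \<phi> \<omega> y (i, r))"
    unfolding bonds by (subst sum.reindex) (auto intro: sum.cong)
  also have "\<dots> = (\<Sum>r\<in>R. \<Sum>i\<in>J r. c_bond \<phi> \<omega> y (i, r))"
    using R finJ by (simp add: sum.Sigma)
  also have "\<dots> = (\<Sum>r\<in>R. \<Sum>V\<in>Tr. measure lebesgue (convex hull V) * phi \<phi> (DrT y r V))"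
  proof (rule sum.cong[OF refl])
    fix r assume r: "r \<in> R"
    then have "(\<Sum>i\<in>J r. c_bond \<phi> \<omega> y (i, r)) =
      (\<Sum>i\<in>J r. \<Sum>V\<in>Tr. phi \<phi> (DrT y r V) * integral {0..1} (\<lambda>l. half_weight (convex hull V) (i + l *\<^sub>R r)))"
      using R by (intro sum.cong refl c_bond_eq_sum[OF tri reg P1]) auto
    also have "\<dots> = (\<Sum>V\<in>Tr. phi \<phi> (DrT y r V) * (\<Sum>i\<in>J r. integral {0..1} (\<lambda>l. half_weight (convex hull V) (i + l *\<^sub>R r))))"
      by (subst sum.swap) (simp add: sum_distrib_left)
    also have "\<dots> = (\<Sum>V\<in>Tr. measure lebesgue (convex hull V) * phi \<phi> (DrT y r V))"
      using dens[OF r] by (simp add: mult.commute)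
    finally show "(\<Sum>i\<in>J r. c_bond \<phi> \<omega> y (i, r)) = \<dots>" .
  qed
  also have "\<dots> = E_c \<phi> Tr R y"
    unfolding E_c_def by (rule sum.swap)
  finally show "(\<Sum>b\<in>bonds \<Omega> R. c_bond \<phi> \<omega> y b) = E_c \<phi> Tr R y" .
qed

theorem theorem4p3:
  fixes \<Omega> \<Omega>a \<Omega>c :: "pt set" and Tr :: "pt set set" and R :: "pt set"
    and \<phi> :: "real \<Rightarrow> real" and y :: "pt \<Rightarrow> pt"
  assumes "open \<Omega>" and "bounded \<Omega>"
    and "open \<Omega>a" and "\<Omega>a \<subseteq> \<Omega>"
    and "\<Omega>c = \<Omega> - closure \<Omega>a"
    and "open_lattice_polygon \<Omega>c"
    and "lattice_triangulation Tr (closure \<Omega>c)"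
    and "finite R" and "R \<subseteq> Z2 - {0}"
    and "continuous_on {0..} \<phi>"
    and "A2 \<Omega> \<Omega>c R"
    and "P1 Tr (closure \<Omega>c) y"
  shows "E_ecc \<phi> \<Omega> \<Omega>c R y =
    (\<Sum>b\<in>{(i, r)\<in>bonds \<Omega> R. \<not> open_segment i (i + r) \<subseteq> \<Omega>c}.
        e_bond \<phi> y b - c_bond \<phi> \<Omega>c y b) + E_c \<phi> Tr R y"
proof -
  have reg: "\<Omega>c = interior (closure \<Omega>c)"
    using assms(6) by (simp add: open_lattice_polygon_def)
  note sum = sum_c_bond[OF assms(7) reg assms(12) assms(8,9,11,2)]
  let ?P = "{(i, r)\<in>bonds \<Omega> R. \<not> open_segment i (i + r) \<subseteq> \<Omega>c}"
  let ?Q = "{(i, r)\<in>bonds \<Omega> R. open_segment i (i + r) \<subseteq> \<Omega>c}"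
  have "?P \<union> ?Q = bonds \<Omega> R" "?P \<inter> ?Q = {}"
    by auto
  \<comment> \<open>The sum of \<open>c_bond\<close> over the bonds inside the polygon is thus
    \<open>E_c\<close> minus the sum over the remaining bonds, which is the correction term of the
    claim.\<close>
  then have "(\<Sum>b\<in>?P. c_bond \<phi> \<Omega>c y b) + (\<Sum>b\<in>?Q. c_bond \<phi> \<Omega>c y b) = E_c \<phi> Tr R y"
    using sum by (metis (no_types, lifting) finite_Un sum.union_disjoint)
  then show ?thesis
    by (simp add: E_ecc_def sum_subtractf)
qed

end
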